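(* Let $K$ be a field of characteristic $\neq 2$ and let $N$ be an indecomposable associative nil evolution $K$-algebra of dimension $n\geq 3$ with $\dim(\mathrm{ann}(N))=1$. Let $B=\{e_1,\dots,e_n\}$ be a natural basis of $N$ with $\mathrm{ann}(N)=Ke_n$, so that $e_i^2=\alpha_ie_n$ with $\alpha_i\in K\setminus\{0\}$ for $1\le i\le n-1$ and $e_n^2=0$. Identify endomorphisms of $N$ with their matrices in the basis $B$, let $e_{ji}$ denote the matrix unit corresponding to the endomorphism sending $e_i$ to $e_j$ and all other basis vectors to $0$, and set $$H=\langle h_{ji}=e_{ji}-\alpha_i^{-1}\alpha_je_{ij}\;;\;1\le i<j\le n-1\rangle,\quad L=\langle e_{nj}\;;\;1\le j\le n-1\rangle,\quad g=e_{11}+\cdots+e_{n-1,n-1}+2e_{nn},$$ where $\langle\cdot\rangle$ denotes $K$-linear span. Then $\mathfrak{D}(N)=H\oplus L\oplus Kg$, and $\mathfrak{D}(N)\simeq K^{\frac{n(n-1)}{2}}\times K$ as a vector space.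
   Context: An evolution $K$-algebra is a finite-dimensional commutative (not necessarily associative) $K$-algebra having a basis $\{e_1,\dots,e_n\}$ (a natural basis) with $e_ie_j=0$ for $i\ne j$. It is nil if for every $a$ some power $a^m$ is $0$ ($a^1=a$, $a^{k+1}=a^ka$). It is indecomposable if it is not the direct sum of two nonzero ideals. $\mathrm{ann}(N)=\{x\in N:xN=0\}$; for a natural basis it is the span of those $e_i$ with $e_i^2=0$. It is a known fact that, in an associative nil evolution algebra, the square of every natural basis vector lies in $\mathrm{ann}(N)$, which gives the stated form of the multiplication. $\mathfrak{D}(N)$ is the space of derivations of $N$, i.e. linear maps $d:N\to N$ with $d(uv)=ud(v)+d(u)v$. *)

theory Defs
  imports Complex_Main "HOL-Library.Function_Algebras" "HOL-Library.Product_Plus"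
begin

section \<open>Commutative, not necessarily associative algebras\<close>

text \<open>The algebra is the whole type \<open>'v\<close>.\<close>

locale comm_algebra = vector_space scale
  for scale :: "'k::field \<Rightarrow> 'v::ab_group_add \<Rightarrow> 'v" +
  fixes mul :: "'v \<Rightarrow> 'v \<Rightarrow> 'v"
  assumes mul_add_left: "mul (x + y) z = mul x z + mul y z"
    and mul_scale_left: "mul (scale c x) z = scale c (mul x z)"
    and mul_commute: "mul x y = mul y x"

text \<open>A basis is given as a family \<open>e 1, \<dots>, e n\<close>; values of \<open>e\<close> outside \<open>{1..n}\<close>
  are irrelevant.\<close>

definition natural_basis ::
  "('k::field \<Rightarrow> 'v::ab_group_add \<Rightarrow> 'v) \<Rightarrow> ('v \<Rightarrow> 'v \<Rightarrow> 'v) \<Rightarrow> nat \<Rightarrow> (nat \<Rightarrow> 'v) \<Rightarrow> bool" where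
  "natural_basis scale mul n e \<longleftrightarrow>
     inj_on e {1..n} \<and>
     \<not> module.dependent scale (e ` {1..n}) \<and>
     module.span scale (e ` {1..n}) = UNIV \<and>
     (\<forall>i\<in>{1..n}. \<forall>j\<in>{1..n}. i \<noteq> j \<longrightarrow> mul (e i) (e j) = 0)"

locale evolution_algebra = comm_algebra scale mul
  for scale :: "'k::field \<Rightarrow> 'v::ab_group_add \<Rightarrow> 'v" and mul :: "'v \<Rightarrow> 'v \<Rightarrow> 'v" +
  assumes ex_natural_basis: "\<exists>n e. natural_basis scale mul n e"

definition associative :: "('v \<Rightarrow> 'v \<Rightarrow> 'v) \<Rightarrow> bool" where
  "associative mul \<longleftrightarrow> (\<forall>x y z. mul (mul x y) z = mul x (mul y z))"

text \<open>Right-iterated powers; only exponents \<open>m \<ge> 1\<close> are meaningful.\<close>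

fun mul_power :: "('v \<Rightarrow> 'v \<Rightarrow> 'v) \<Rightarrow> 'v \<Rightarrow> nat \<Rightarrow> 'v" where
  "mul_power mul a 0 = a"
| "mul_power mul a (Suc 0) = a"
| "mul_power mul a (Suc (Suc k)) = mul (mul_power mul a (Suc k)) a"

definition nil_algebra :: "('v::zero \<Rightarrow> 'v \<Rightarrow> 'v) \<Rightarrow> bool" where
  "nil_algebra mul \<longleftrightarrow> (\<forall>a. \<exists>m\<ge>1. mul_power mul a m = 0)"

definition annihilator :: "('v::zero \<Rightarrow> 'v \<Rightarrow> 'v) \<Rightarrow> 'v set" where
  "annihilator mul = {x. \<forall>y. mul x y = 0}"

definition algebra_ideal ::
  "('k::field \<Rightarrow> 'v::ab_group_add \<Rightarrow> 'v) \<Rightarrow> ('v \<Rightarrow> 'v \<Rightarrow> 'v) \<Rightarrow> 'v set \<Rightarrow> bool" where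
  "algebra_ideal scale mul I \<longleftrightarrow>
     module.subspace scale I \<and> (\<forall>x\<in>I. \<forall>a. mul a x \<in> I \<and> mul x a \<in> I)"

text \<open>Internal direct sums of subgroups.\<close>

definition direct_sum2 :: "'v::ab_group_add set \<Rightarrow> 'v set \<Rightarrow> 'v set \<Rightarrow> bool" where
  "direct_sum2 V A B \<longleftrightarrow>
     V = {a + b | a b. a \<in> A \<and> b \<in> B} \<and>
     (\<forall>a\<in>A. \<forall>b\<in>B. a + b = 0 \<longrightarrow> a = 0 \<and> b = 0)"

definition direct_sum3 :: "'v::ab_group_add set \<Rightarrow> 'v set \<Rightarrow> 'v set \<Rightarrow> 'v set \<Rightarrow> bool" where
  "direct_sum3 V A B C \<longleftrightarrow>
     V = {a + b + c | a b c. a \<in> A \<and> b \<in> B \<and> c \<in> C} \<and>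
     (\<forall>a\<in>A. \<forall>b\<in>B. \<forall>c\<in>C. a + b + c = 0 \<longrightarrow> a = 0 \<and> b = 0 \<and> c = 0)"

definition indecomposable_algebra ::
  "('k::field \<Rightarrow> 'v::ab_group_add \<Rightarrow> 'v) \<Rightarrow> ('v \<Rightarrow> 'v \<Rightarrow> 'v) \<Rightarrow> bool" where
  "indecomposable_algebra scale mul \<longleftrightarrow>
     \<not> (\<exists>I J. algebra_ideal scale mul I \<and> algebra_ideal scale mul J \<and>
            I \<noteq> {0} \<and> J \<noteq> {0} \<and> direct_sum2 UNIV I J)"

definition derivations ::
  "('k::field \<Rightarrow> 'v::ab_group_add \<Rightarrow> 'v) \<Rightarrow> ('v \<Rightarrow> 'v \<Rightarrow> 'v) \<Rightarrow> ('v \<Rightarrow> 'v) set" where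
  "derivations scale mul =
     {d. Vector_Spaces.linear scale scale d \<and> (\<forall>u v. d (mul u v) = mul u (d v) + mul (d u) v)}"


section \<open>Endomorphisms\<close>

text \<open>Addition of functions is the pointwise one of \<^theory>\<open>HOL-Library.Function_Algebras\<close>.\<close>

definition fun_scale :: "('k \<Rightarrow> 'v \<Rightarrow> 'v) \<Rightarrow> 'k \<Rightarrow> ('a \<Rightarrow> 'v) \<Rightarrow> 'a \<Rightarrow> 'v" where
  "fun_scale scale c f = (\<lambda>x. scale c (f x))"

lemma (in vector_space) vector_space_fun_scale: "vector_space (fun_scale scale)"
  by unfold_locales
    (simp_all add: fun_scale_def fun_eq_iff scale_right_distrib scale_left_distrib)

text \<open>\<open>matrix_unit scale n e r s\<close> has its entry 1 in row \<open>r\<close> and column \<open>s\<close>: it is the linear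
  map with \<open>e s \<mapsto> e r\<close> that kills the other basis vectors.\<close>

definition matrix_unit ::
  "('k::field \<Rightarrow> 'v::ab_group_add \<Rightarrow> 'v) \<Rightarrow> nat \<Rightarrow> (nat \<Rightarrow> 'v) \<Rightarrow> nat \<Rightarrow> nat \<Rightarrow> 'v \<Rightarrow> 'v" where
  "matrix_unit scale n e r s =
     vector_space_pair.construct scale scale (e ` {1..n}) (\<lambda>b. if b = e s then e r else 0)"

lemma (in vector_space) matrix_unit_basis:
  assumes "inj_on e {1..n}" "independent (e ` {1..n})" "s \<in> {1..n}" "k \<in> {1..n}"
  shows "matrix_unit scale n e r s (e k) = (if k = s then e r else 0)"
proof -
  interpret vector_space_pair scale scale by unfold_locales
  show ?thesis
    using assms by (auto simp: matrix_unit_def construct_basis dest: inj_onD)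
qed

lemma (in vector_space) linear_matrix_unit:
  assumes "independent (e ` {1..n})"
  shows "Vector_Spaces.linear scale scale (matrix_unit scale n e r s)"
proof -
  interpret vector_space_pair scale scale by unfold_locales
  show ?thesis
    unfolding matrix_unit_def using assms by (rule linear_construct)
qed

definition H_space ::
  "('k::field \<Rightarrow> 'v::ab_group_add \<Rightarrow> 'v) \<Rightarrow> nat \<Rightarrow> (nat \<Rightarrow> 'v) \<Rightarrow> (nat \<Rightarrow> 'k) \<Rightarrow> ('v \<Rightarrow> 'v) set" where
  "H_space scale n e \<alpha> =
     module.span (fun_scale scale)
       {matrix_unit scale n e j i
          - fun_scale scale (inverse (\<alpha> i) * \<alpha> j) (matrix_unit scale n e i j) | i j.
          1 \<le> i \<and> i < j \<and> j \<le> n - 1}"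

definition L_space ::
  "('k::field \<Rightarrow> 'v::ab_group_add \<Rightarrow> 'v) \<Rightarrow> nat \<Rightarrow> (nat \<Rightarrow> 'v) \<Rightarrow> ('v \<Rightarrow> 'v) set" where
  "L_space scale n e =
     module.span (fun_scale scale) {matrix_unit scale n e n j | j. 1 \<le> j \<and> j \<le> n - 1}"

definition g_map ::
  "('k::field \<Rightarrow> 'v::ab_group_add \<Rightarrow> 'v) \<Rightarrow> nat \<Rightarrow> (nat \<Rightarrow> 'v) \<Rightarrow> 'v \<Rightarrow> 'v" where
  "g_map scale n e =
     (\<Sum>i = 1..n - 1. matrix_unit scale n e i i) + fun_scale scale 2 (matrix_unit scale n e n n)"


section \<open>Linear isomorphism and coordinate spaces\<close>

definition linear_isomorphic ::
  "('k \<Rightarrow> 'v::plus \<Rightarrow> 'v) \<Rightarrow> 'v set \<Rightarrow> ('k \<Rightarrow> 'w::plus \<Rightarrow> 'w) \<Rightarrow> 'w set \<Rightarrow> bool" where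
  "linear_isomorphic scale1 V scale2 W \<longleftrightarrow>
     (\<exists>\<phi>. bij_betw \<phi> V W \<and>
          (\<forall>x\<in>V. \<forall>y\<in>V. \<phi> (x + y) = \<phi> x + \<phi> y) \<and>
          (\<forall>c. \<forall>x\<in>V. \<phi> (scale1 c x) = scale2 c (\<phi> x)))"

text \<open>\<open>K\<^sup>m\<close> as the sequences vanishing from index \<open>m\<close> on, since \<open>m\<close> depends on a term and
  cannot be a type.\<close>

definition coord_space :: "nat \<Rightarrow> (nat \<Rightarrow> 'k::zero) set" where
  "coord_space m = {x. \<forall>i\<ge>m. x i = 0}"

definition coord_scale ::
  "'k::times \<Rightarrow> (nat \<Rightarrow> 'k) \<times> 'k \<Rightarrow> (nat \<Rightarrow> 'k) \<times> 'k" where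
  "coord_scale c p = ((\<lambda>i. c * fst p i), c * snd p)"

end

theory Submission
  imports Defs
begin

text \<open>
  The square of a natural basis vector \<open>e i\<close> lies in the annihilator: associativity gives
  \<open>(e i \<cdot> e i) \<cdot> e j = e i \<cdot> (e i \<cdot> e j) = 0\<close> for \<open>j \<noteq> i\<close>, and \<open>(e i \<cdot> e i) \<cdot> e i\<close> is a multiple
  \<open>c \<cdot> (e i \<cdot> e i)\<close>, so that the powers of \<open>e i\<close> are \<open>c ^ k \<cdot> (e i \<cdot> e i)\<close> and nilpotency forces
  this multiple to vanish (\<open>square_basis_annihilator\<close>). Since the annihilator is the line
  through \<open>e n\<close>, all products lie on that line, and the algebra is a diagonal
  quadratic form \<open>\<alpha> 1, \<dots>, \<alpha> (n - 1)\<close> with values in \<open>K e n\<close>.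

  For such an algebra, the Leibniz rule needs to be checked on basis vectors only, and each pair
  \<open>i, j\<close> contributes one equation on the matrix of the linear map \<open>d\<close>
  (\<open>derivations_iff_matrix\<close>). The pairs \<open>i \<noteq> j\<close> below \<open>n\<close> say that the upper left block is skew
  with respect to the quadratic form; the pairs \<open>i, n\<close> say that the last column vanishes
  above the diagonal; the pairs \<open>i, i\<close> say that \<open>d (e n)\<close> is twice the \<open>i\<close>-th diagonal entry
  times \<open>e n\<close>, so that, as \<open>2 \<noteq> 0\<close>, the first \<open>n - 1\<close> diagonal entries agree. The entries below
  the diagonal and the common diagonal entry therefore determine \<open>d\<close>, and they can be
  prescribed freely.

  Both conclusions are read off this parametrisation \<open>normal_form\<close>. Grouping its terms into the
  skew part, the last row and the multiple of \<open>g\<close> gives the direct sum. The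
  \<open>n (n - 1) / 2\<close> places below the diagonal, those of the last row included, together with the
  diagonal entry give the coordinates on the space of derivations.
\<close>

section \<open>Coordinates with respect to a finite basis\<close>

locale indexed_basis = vector_space scale
  for scale :: "'k::field \<Rightarrow> 'v::ab_group_add \<Rightarrow> 'v" +
  fixes n :: nat and e :: "nat \<Rightarrow> 'v"
  assumes inj_basis: "inj_on e {1..n}"
    and independent_basis: "independent (e ` {1..n})"
    and span_basis: "span (e ` {1..n}) = UNIV"
begin

sublocale vector_space_pair scale scale by unfold_locales

sublocale endo: vector_space "fun_scale scale" by (rule vector_space_fun_scale)

definition coord :: "nat \<Rightarrow> 'v \<Rightarrow> 'k" where
  "coord i v = representation (e ` {1..n}) v (e i)"

definition entry :: "nat \<Rightarrow> nat \<Rightarrow> ('v \<Rightarrow> 'v) \<Rightarrow> 'k" where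
  "entry r s f = coord r (f (e s))"

lemma coord_add: "coord i (x + y) = coord i x + coord i y"
  unfolding coord_def by (subst representation_add) (use independent_basis span_basis in auto)

lemma coord_scale: "coord i (scale c x) = c * coord i x"
  unfolding coord_def by (subst representation_scale) (use independent_basis span_basis in auto)

lemma coord_zero [simp]: "coord i 0 = 0"
  using coord_scale[of i 0 0] by simp

lemma coord_basis:
  assumes "i \<in> {1..n}" "j \<in> {1..n}"
  shows "coord i (e j) = (if i = j then 1 else 0)"
  unfolding coord_def using assms inj_basis independent_basis
  by (subst representation_basis) (auto simp: inj_on_eq_iff)

lemma coord_expansion: "(\<Sum>i = 1..n. scale (coord i v) (e i)) = v"
proof -
  have "(\<Sum>b\<in>e ` {1..n}. scale (representation (e ` {1..n}) v b) b) = v"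
    by (rule sum_representation_eq) (use independent_basis span_basis in auto)
  then show ?thesis
    unfolding sum.reindex[OF inj_basis] o_def coord_def .
qed

lemma vec_eqI:
  assumes "\<And>i. i \<in> {1..n} \<Longrightarrow> coord i x = coord i y"
  shows "x = y"
  using coord_expansion[of x] coord_expansion[of y] assms
  by (metis (mono_tags, lifting) sum.cong)

lemma entry_add: "entry r s (f + h) = entry r s f + entry r s h"
  by (simp add: entry_def coord_add)

lemma entry_scale: "entry r s (fun_scale scale c f) = c * entry r s f"
  by (simp add: entry_def fun_scale_def coord_scale)

lemma entry_diff: "entry r s (f - h) = entry r s f - entry r s h"
  using entry_add[of r s "f - h" h] by simp

lemma entry_zero [simp]: "entry r s 0 = 0"
  by (simp add: entry_def)

lemma entry_sum: "entry r s (\<Sum>p\<in>A. f p) = (\<Sum>p\<in>A. entry r s (f p))"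
  by (induction A rule: infinite_finite_induct) (simp_all add: entry_def coord_add)

lemma entry_matrix_unit:
  assumes "r \<in> {1..n}" "s \<in> {1..n}" "i \<in> {1..n}" "j \<in> {1..n}"
  shows "entry r s (matrix_unit scale n e i j) = (if r = i \<and> s = j then 1 else 0)"
  using assms
  by (simp add: entry_def matrix_unit_basis[OF inj_basis independent_basis] coord_basis)

lemma linear_endoI:
  assumes "\<And>x y. f (x + y) = f x + f y" "\<And>c x. f (scale c x) = scale c (f x)"
  shows "Vector_Spaces.linear scale scale f"
  using assms by (simp add: Vector_Spaces.linear_iff vector_space_axioms)

lemma linear_eq_basisI:
  assumes "Vector_Spaces.linear scale scale f" "Vector_Spaces.linear scale scale h"
    and "\<And>s. s \<in> {1..n} \<Longrightarrow> f (e s) = h (e s)"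
  shows "f = h"
proof
  fix x
  show "f x = h x"
    by (rule linear_eq_on[OF assms(1,2), of x "e ` {1..n}"]) (use assms(3) span_basis in auto)
qed

lemma endo_eqI:
  assumes "Vector_Spaces.linear scale scale f" "Vector_Spaces.linear scale scale h"
    and "\<And>r s. r \<in> {1..n} \<Longrightarrow> s \<in> {1..n} \<Longrightarrow> entry r s f = entry r s h"
  shows "f = h"
  by (rule linear_eq_basisI[OF assms(1,2)], rule vec_eqI) (use assms(3) in \<open>simp add: entry_def\<close>)

end


section \<open>Derivations as matrices\<close>

context comm_algebra
begin

lemma mul_add_right: "mul x (y + z) = mul x y + mul x z"
  by (metis mul_add_left mul_commute)

lemma mul_scale_right: "mul x (scale c y) = scale c (mul x y)"
  by (metis mul_scale_left mul_commute)

lemma linear_mul_right: "Vector_Spaces.linear scale scale (mul u)"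
  by (simp add: Vector_Spaces.linear_iff mul_add_right mul_scale_right vector_space_axioms)

end

text \<open>The quadratic form is nondegenerate on the span of \<open>e 1, \<dots>, e (n - 1)\<close> and takes its
  values in the line through \<open>e n\<close>.\<close>

locale line_valued_evolution = comm_algebra scale mul + indexed_basis scale n e
  for scale :: "'k::field \<Rightarrow> 'v::ab_group_add \<Rightarrow> 'v" and mul :: "'v \<Rightarrow> 'v \<Rightarrow> 'v"
    and n :: nat and e :: "nat \<Rightarrow> 'v" +
  fixes \<alpha> :: "nat \<Rightarrow> 'k"
  assumes n_ge_2: "n \<ge> 2"
    and orthogonal: "i \<in> {1..n} \<Longrightarrow> j \<in> {1..n} \<Longrightarrow> i \<noteq> j \<Longrightarrow> mul (e i) (e j) = 0"
    and squares: "i \<in> {1..n - 1} \<Longrightarrow> mul (e i) (e i) = scale (\<alpha> i) (e n)"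
    and square_last: "mul (e n) (e n) = 0"
    and \<alpha>_nonzero: "i \<in> {1..n - 1} \<Longrightarrow> \<alpha> i \<noteq> 0"
    and two_nonzero: "(2::'k) \<noteq> 0"
begin

text \<open>The coefficients of the quadratic form on all of \<open>{1..n}\<close>. The value of \<open>\<alpha>\<close> at \<open>n\<close> is
  arbitrary, and giving \<open>e n\<close> the weight 0 makes the formulas for products and derivations
  uniform in the index.\<close>

definition weight :: "nat \<Rightarrow> 'k" where
  "weight i = (if i = n then 0 else \<alpha> i)"

lemma mul_basis:
  assumes "i \<in> {1..n}" "j \<in> {1..n}"
  shows "mul (e i) (e j) = (if i = j then scale (weight i) (e n) else 0)"
  using assms orthogonal squares[of i] square_last by (auto simp: weight_def)

lemma mul_basis_left:
  assumes "i \<in> {1..n}"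
  shows "mul (e i) v = scale (weight i * coord i v) (e n)"
proof -
  have "mul (e i) = (\<lambda>v. scale (weight i * coord i v) (e n))"
    by (rule linear_eq_basisI[OF linear_mul_right linear_endoI])
      (use assms in \<open>auto simp: coord_add coord_scale mul_basis coord_basis
        distrib_left scale_left_distrib mult.left_commute\<close>)
  then show ?thesis by simp
qed

lemma mul_basis_right:
  assumes "i \<in> {1..n}"
  shows "mul v (e i) = scale (weight i * coord i v) (e n)"
  using mul_basis_left[OF assms] mul_commute by metis

text \<open>Both sides of the Leibniz rule are bilinear in the two factors.\<close>

lemma derivation_on_basisI:
  assumes d: "Vector_Spaces.linear scale scale d"
    and basis: "\<And>i j. i \<in> {1..n} \<Longrightarrow> j \<in> {1..n} \<Longrightarrow>
      d (mul (e i) (e j)) = mul (e i) (d (e j)) + mul (d (e i)) (e j)"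
  shows "d \<in> derivations scale mul"
proof -
  note d_simps = linear_add[OF d] linear_scale[OF d] mul_add_left mul_scale_left
    mul_add_right mul_scale_right scale_right_distrib add_ac
  have left: "(\<lambda>v. d (mul (e i) v)) = (\<lambda>v. mul (e i) (d v) + mul (d (e i)) v)"
    if "i \<in> {1..n}" for i
    by (rule linear_eq_basisI[OF linear_endoI linear_endoI])
      (use that basis in \<open>auto simp: d_simps\<close>)
  have "(\<lambda>u. d (mul u v)) = (\<lambda>u. mul u (d v) + mul (d u) v)" for v
    by (rule linear_eq_basisI[OF linear_endoI linear_endoI])
      (use fun_cong[OF left] in \<open>auto simp: d_simps\<close>)
  then show ?thesis
    using d by (auto simp: derivations_def fun_eq_iff)
qed

text \<open>All terms of the Leibniz rule for \<open>e i\<close> and \<open>e j\<close> are multiples of \<open>e n\<close>, except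
  \<open>d (e i \<cdot> e i)\<close>, which is a multiple of \<open>d (e n)\<close>.\<close>

lemma derivations_iff_matrix:
  "d \<in> derivations scale mul \<longleftrightarrow> Vector_Spaces.linear scale scale d \<and>
    (\<forall>i\<in>{1..n}. scale (weight i) (d (e n)) = scale (2 * weight i * entry i i d) (e n)) \<and>
    (\<forall>i\<in>{1..n}. \<forall>j\<in>{1..n}. i \<noteq> j \<longrightarrow> weight i * entry i j d + weight j * entry j i d = 0)"
proof -
  have e_n: "e n \<noteq> 0"
    using coord_basis[of n n] n_ge_2 by auto
  have leibniz: "d (mul (e i) (e j)) = mul (e i) (d (e j)) + mul (d (e i)) (e j) \<longleftrightarrow>
      (if i = j then scale (weight i) (d (e n)) = scale (2 * weight i * entry i i d) (e n)
       else weight i * entry i j d + weight j * entry j i d = 0)"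
    if "Vector_Spaces.linear scale scale d" "i \<in> {1..n}" "j \<in> {1..n}" for i j
    unfolding mul_basis[OF that(2,3)]
    unfolding mul_basis_left[OF that(2)] mul_basis_right[OF that(3)]
    by (cases "i = j")
      (simp_all add: linear_0[OF that(1)] linear_scale[OF that(1)] entry_def e_n mult.assoc
        flip: scale_left_distrib)
  show ?thesis (is "_ \<longleftrightarrow> ?lin \<and> ?diag \<and> ?off")
  proof
    assume "d \<in> derivations scale mul"
    then have d: "?lin" "\<And>u v. d (mul u v) = mul u (d v) + mul (d u) v"
      by (auto simp: derivations_def)
    then show "?lin \<and> ?diag \<and> ?off"
      using leibniz[OF d(1)] by auto
  next
    assume "?lin \<and> ?diag \<and> ?off"
    then show "d \<in> derivations scale mul"
      using leibniz by (intro derivation_on_basisI) auto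
  qed
qed

text \<open>The vector \<open>d (e n)\<close> is \<open>2 \<cdot> entry i i d\<close> times \<open>e n\<close> for every \<open>i < n\<close>.
  Comparing two such indices is the step that divides by 2.\<close>

lemma derivation_entries:
  assumes d: "d \<in> derivations scale mul"
  shows derivation_diagonal: "i \<in> {1..n - 1} \<Longrightarrow> entry i i d = entry 1 1 d"
    and derivation_last: "entry n n d = 2 * entry 1 1 d"
    and derivation_last_column: "i \<in> {1..n - 1} \<Longrightarrow> entry i n d = 0"
    and derivation_skew: "i \<in> {1..n - 1} \<Longrightarrow> j \<in> {1..n - 1} \<Longrightarrow> i \<noteq> j \<Longrightarrow>
      entry i j d = - (inverse (\<alpha> i) * \<alpha> j * entry j i d)"
proof -
  have en: "d (e n) = scale (2 * entry i i d) (e n)" if "i \<in> {1..n - 1}" for i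
  proof -
    have "scale (\<alpha> i) (d (e n)) = scale (\<alpha> i) (scale (2 * entry i i d) (e n))"
    proof -
      have "i \<in> {1..n}" "weight i = \<alpha> i" using that by (auto simp: weight_def)
      then show ?thesis
        using d unfolding derivations_iff_matrix by (metis scale_scale mult.assoc mult.commute)
    qed
    then show ?thesis using \<alpha>_nonzero[OF that] scale_left_imp_eq by blast
  qed
  have last: "entry n n d = 2 * entry i i d" if "i \<in> {1..n - 1}" for i
    using en[OF that] n_ge_2 by (simp add: entry_def[of n n] coord_scale coord_basis)
  have one: "1 \<in> {1..n - 1}" using n_ge_2 by auto
  show "entry n n d = 2 * entry 1 1 d"
    using last[OF one] .
  show "entry i i d = entry 1 1 d" if "i \<in> {1..n - 1}"
    using last[OF one] last[OF that] two_nonzero by simp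
  show "entry i n d = 0" if "i \<in> {1..n - 1}"
    using en[OF one] that n_ge_2
    by (auto simp: entry_def coord_scale coord_basis split: if_splits)
  show "entry i j d = - (inverse (\<alpha> i) * \<alpha> j * entry j i d)"
    if "i \<in> {1..n - 1}" "j \<in> {1..n - 1}" "i \<noteq> j"
  proof -
    have "\<alpha> i * entry i j d + \<alpha> j * entry j i d = 0"
    proof -
      have "i \<in> {1..n}" "weight i = \<alpha> i" "j \<in> {1..n}" "weight j = \<alpha> j"
        using that by (auto simp: weight_def)
      then show ?thesis
        using d that(3) unfolding derivations_iff_matrix by metis
    qed
    with \<alpha>_nonzero[OF that(1)] show ?thesis
      by (simp add: field_simps eq_neg_iff_add_eq_0)
  qed
qed

section \<open>Normal form of a derivation\<close>

definition h_map :: "nat \<Rightarrow> nat \<Rightarrow> 'v \<Rightarrow> 'v" where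
  "h_map i j = matrix_unit scale n e j i
     - fun_scale scale (inverse (\<alpha> i) * \<alpha> j) (matrix_unit scale n e i j)"

text \<open>A pair \<open>(i, j)\<close> stands for the place in column \<open>i\<close> and row \<open>j\<close>.\<close>

definition below_diagonal :: "nat \<Rightarrow> (nat \<times> nat) set" where
  "below_diagonal m = {(i, j). 1 \<le> i \<and> i < j \<and> j \<le> m}"

definition H_part :: "(nat \<Rightarrow> nat \<Rightarrow> 'k) \<Rightarrow> 'v \<Rightarrow> 'v" where
  "H_part a = (\<Sum>(i, j)\<in>below_diagonal (n - 1). fun_scale scale (a j i) (h_map i j))"

definition L_part :: "(nat \<Rightarrow> nat \<Rightarrow> 'k) \<Rightarrow> 'v \<Rightarrow> 'v" where
  "L_part a = (\<Sum>j = 1..n - 1. fun_scale scale (a n j) (matrix_unit scale n e n j))"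

text \<open>Only the values \<open>a r s\<close> with \<open>s < r\<close> enter, so that \<open>a\<close> is a prescription for the
  places below the diagonal.\<close>

definition normal_form :: "(nat \<Rightarrow> nat \<Rightarrow> 'k) \<Rightarrow> 'k \<Rightarrow> 'v \<Rightarrow> 'v" where
  "normal_form a c = H_part a + L_part a + fun_scale scale c (g_map scale n e)"

lemma finite_below_diagonal: "finite (below_diagonal m)"
  by (rule finite_subset[of _ "{1..m} \<times> {1..m}"]) (auto simp: below_diagonal_def)

lemma H_space_eq: "H_space scale n e \<alpha> = endo.span {h_map i j | i j. (i, j) \<in> below_diagonal (n - 1)}"
  by (simp add: H_space_def h_map_def below_diagonal_def)

lemma H_part_in: "H_part a \<in> H_space scale n e \<alpha>"
  unfolding H_part_def H_space_eq
  by (rule endo.span_sum) (auto intro: endo.span_scale endo.span_base)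

lemma L_part_in: "L_part a \<in> L_space scale n e"
  unfolding L_part_def L_space_def
  by (rule endo.span_sum) (auto intro: endo.span_scale endo.span_base)

lemma entry_h_map:
  assumes "r \<in> {1..n}" "s \<in> {1..n}" "i \<in> {1..n}" "j \<in> {1..n}"
  shows "entry r s (h_map i j) = (if (i, j) = (s, r) then 1 else 0)
     - (if (i, j) = (r, s) then inverse (\<alpha> i) * \<alpha> j else 0)"
  using assms by (auto simp: h_map_def entry_diff entry_scale entry_matrix_unit)

lemma entry_H_part:
  assumes "r \<in> {1..n}" "s \<in> {1..n}"
  shows "entry r s (H_part a) =
    (if s < r \<and> r < n then a r s
     else if r < s \<and> s < n then - (inverse (\<alpha> r) * \<alpha> s * a s r) else 0)"
proof -
  let ?P = "below_diagonal (n - 1)"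
  have "entry r s (H_part a) = (\<Sum>p\<in>?P.
      (if p = (s, r) then a r s else 0) - (if p = (r, s) then a s r * (inverse (\<alpha> r) * \<alpha> s) else 0))"
    unfolding H_part_def entry_sum
  proof (rule sum.cong[OF refl])
    fix p assume "p \<in> ?P"
    moreover obtain i j where p: "p = (i, j)" by (cases p)
    ultimately have ij: "i \<in> {1..n}" "j \<in> {1..n}" "i < j"
      by (auto simp: below_diagonal_def)
    show "entry r s (case p of (i, j) \<Rightarrow> fun_scale scale (a j i) (h_map i j))
        = (if p = (s, r) then a r s else 0)
          - (if p = (r, s) then a s r * (inverse (\<alpha> r) * \<alpha> s) else 0)"
      unfolding p prod.case entry_scale entry_h_map[OF assms ij(1,2)]
      using ij(3) by auto
  qed
  also have "\<dots> = (if (s, r) \<in> ?P then a r s else 0)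
      - (if (r, s) \<in> ?P then a s r * (inverse (\<alpha> r) * \<alpha> s) else 0)"
    by (simp add: sum_subtractf finite_below_diagonal)
  finally show ?thesis
    using assms by (auto simp: below_diagonal_def)
qed

lemma entry_L_part:
  assumes "r \<in> {1..n}" "s \<in> {1..n}"
  shows "entry r s (L_part a) = (if r = n \<and> s < n then a n s else 0)"
proof -
  have "entry r s (L_part a) = (\<Sum>j = 1..n - 1. if j = s then (if r = n then a n s else 0) else 0)"
    unfolding L_part_def entry_sum
    by (rule sum.cong) (use assms in \<open>auto simp: entry_scale entry_matrix_unit\<close>)
  then show ?thesis
    using assms by auto
qed

lemma entry_g_map:
  assumes "r \<in> {1..n}" "s \<in> {1..n}"
  shows "entry r s (g_map scale n e) = (if r = s then (if s = n then 2 else 1) else 0)"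
proof -
  have "(\<Sum>i = 1..n - 1. entry r s (matrix_unit scale n e i i))
      = (\<Sum>i = 1..n - 1. if i = s then (if r = s then 1 else 0) else 0)"
    by (rule sum.cong) (use assms in \<open>auto simp: entry_matrix_unit\<close>)
  also have "\<dots> = (if r = s \<and> s < n then 1 else 0)"
    using assms by auto
  finally have "(\<Sum>i = 1..n - 1. entry r s (matrix_unit scale n e i i)) = \<dots>" .
  then show ?thesis
    using assms n_ge_2 by (auto simp: g_map_def entry_add entry_sum entry_scale entry_matrix_unit)
qed

lemma entry_normal_form:
  assumes "r \<in> {1..n}" "s \<in> {1..n}"
  shows "entry r s (normal_form a c) =
    (if s < r then a r s
     else if r = s then (if s = n then 2 * c else c)
     else if s = n then 0
     else - (inverse (\<alpha> r) * \<alpha> s * a s r))"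
  using assms
  by (auto simp: normal_form_def entry_add entry_scale entry_H_part entry_L_part entry_g_map)

lemma subspace_linear: "endo.subspace {f. Vector_Spaces.linear scale scale f}"
  by (rule endo.subspaceI)
    (auto intro!: linear_endoI
      simp: fun_scale_def linear_add linear_scale scale_right_distrib scale_left_commute)

lemma linear_normal_form: "Vector_Spaces.linear scale scale (normal_form a c)"
proof -
  have mu: "matrix_unit scale n e i j \<in> {f. Vector_Spaces.linear scale scale f}" for i j
    using linear_matrix_unit[OF independent_basis] by simp
  have h: "h_map i j \<in> {f. Vector_Spaces.linear scale scale f}" for i j
    unfolding h_map_def by (intro endo.subspace_diff endo.subspace_scale subspace_linear mu)
  have "normal_form a c \<in> {f. Vector_Spaces.linear scale scale f}"
    unfolding normal_form_def H_part_def L_part_def g_map_def split_def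
    by (intro endo.subspace_add endo.subspace_sum endo.subspace_scale subspace_linear mu h)
  then show ?thesis by simp
qed

lemma normal_form_derivation: "normal_form a c \<in> derivations scale mul"
proof -
  have last: "normal_form a c (e n) = scale (2 * c) (e n)"
    by (rule vec_eqI)
      (use entry_normal_form[of _ n a c] n_ge_2 in
        \<open>auto simp: entry_def coord_scale coord_basis\<close>)
  show ?thesis
    unfolding derivations_iff_matrix
  proof (intro conjI ballI impI)
    fix i j assume ij: "i \<in> {1..n}" "j \<in> {1..n}" "i \<noteq> j"
    then show "weight i * entry i j (normal_form a c) + weight j * entry j i (normal_form a c) = 0"
      using \<alpha>_nonzero[of i] \<alpha>_nonzero[of j]
      by (auto simp: entry_normal_form weight_def)
  qed (auto simp: linear_normal_form last entry_normal_form weight_def ac_simps)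
qed

lemma derivation_eq_normal_form:
  assumes d: "d \<in> derivations scale mul"
  shows "d = normal_form (\<lambda>r s. entry r s d) (entry 1 1 d)"
proof (rule endo_eqI)
  show "Vector_Spaces.linear scale scale d" using d by (simp add: derivations_def)
  fix r s assume rs: "r \<in> {1..n}" "s \<in> {1..n}"
  then show "entry r s d = entry r s (normal_form (\<lambda>r s. entry r s d) (entry 1 1 d))"
    using derivation_diagonal[OF d, of r] derivation_last[OF d]
      derivation_last_column[OF d, of r] derivation_skew[OF d, of r s]
    by (auto simp: entry_normal_form)
qed (rule linear_normal_form)

section \<open>The direct sum\<close>

lemma subspace_derivations: "endo.subspace (derivations scale mul)"
proof -
  have "Vector_Spaces.linear scale scale (0 :: 'v \<Rightarrow> 'v)"
    using endo.subspace_0[OF subspace_linear] by simp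
  then show ?thesis
    using endo.subspace_add[OF subspace_linear] endo.subspace_scale[OF subspace_linear]
    by (auto simp: endo.subspace_def derivations_def fun_scale_def scale_right_distrib
        mul_add_left mul_add_right mul_scale_left mul_scale_right add_ac
        linear_0[OF linear_mul_right] mul_commute[of 0])
qed

text \<open>Generators are normal forms: \<open>h_map i j\<close> and the units of the last row come from the
  indicator function of one place, and \<open>g\<close> from the zero function.\<close>

lemma generators_are_derivations:
  shows h_map_derivation: "(i, j) \<in> below_diagonal (n - 1) \<Longrightarrow> h_map i j \<in> derivations scale mul"
    and last_row_derivation:
      "j \<in> {1..n - 1} \<Longrightarrow> matrix_unit scale n e n j \<in> derivations scale mul"
    and g_map_derivation: "g_map scale n e \<in> derivations scale mul"
proof -
  have lin: "Vector_Spaces.linear scale scale (matrix_unit scale n e i j)" for i j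
    using linear_matrix_unit[OF independent_basis] .
  have nf: "f \<in> derivations scale mul" if "f = normal_form a c" for f a c
    using that normal_form_derivation by simp
  show "matrix_unit scale n e n j \<in> derivations scale mul" if "j \<in> {1..n - 1}"
  proof (rule nf, rule endo_eqI[OF lin linear_normal_form])
    fix r s assume "r \<in> {1..n}" "s \<in> {1..n}"
    with that show "entry r s (matrix_unit scale n e n j)
        = entry r s (normal_form (\<lambda>r s. if r = n \<and> s = j then 1 else 0) 0)"
      by (auto simp: entry_matrix_unit entry_normal_form)
  qed
  show "h_map i j \<in> derivations scale mul" if "(i, j) \<in> below_diagonal (n - 1)"
  proof (rule nf, rule endo_eqI[OF _ linear_normal_form])
    show "Vector_Spaces.linear scale scale (h_map i j)"
      using endo.subspace_diff[OF subspace_linear] endo.subspace_scale[OF subspace_linear] lin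
      by (auto simp: h_map_def)
    fix r s assume "r \<in> {1..n}" "s \<in> {1..n}"
    with that show "entry r s (h_map i j)
        = entry r s (normal_form (\<lambda>r s. if r = j \<and> s = i then 1 else 0) 0)"
      by (auto simp: entry_h_map entry_normal_form below_diagonal_def)
  qed
  have "g_map scale n e = normal_form (\<lambda>r s. 0) 1"
    unfolding normal_form_def H_part_def L_part_def by simp
  then show "g_map scale n e \<in> derivations scale mul" by (rule nf)
qed

lemma H_space_derivations: "H_space scale n e \<alpha> \<subseteq> derivations scale mul"
  unfolding H_space_eq
  by (rule endo.span_minimal[OF _ subspace_derivations]) (auto intro: h_map_derivation)

lemma L_space_derivations: "L_space scale n e \<subseteq> derivations scale mul"
  unfolding L_space_def
  by (rule endo.span_minimal[OF _ subspace_derivations]) (auto intro: last_row_derivation)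

text \<open>The three summands are supported on disjoint sets of places: off the diagonal of the upper
  left block, in the last row before the diagonal, and on the diagonal. The next two lemmas record as much of this
  as is needed to separate them.\<close>

lemma H_space_entries:
  assumes "f \<in> H_space scale n e \<alpha>" "s \<in> {1..n}"
  shows "entry s s f = 0" "entry n s f = 0"
proof -
  let ?S = "{f. \<forall>s\<in>{1..n}. entry s s f = 0 \<and> entry n s f = 0}"
  have "endo.subspace ?S"
    by (auto simp: endo.subspace_def entry_add entry_scale)
  then have "H_space scale n e \<alpha> \<subseteq> ?S"
    unfolding H_space_eq
    by (rule endo.span_minimal[rotated]) (auto simp: entry_h_map below_diagonal_def)
  then show "entry s s f = 0" "entry n s f = 0"
    using assms by auto
qed

lemma L_space_entries:
  assumes "f \<in> L_space scale n e" "r \<in> {1..n}" "s \<in> {1..n}" "r \<noteq> n \<or> s = n"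
  shows "entry r s f = 0"
proof -
  let ?S = "{f. entry r s f = 0}"
  have "endo.subspace ?S"
    by (auto simp: endo.subspace_def entry_add entry_scale)
  then have "L_space scale n e \<subseteq> ?S"
    unfolding L_space_def
    by (rule endo.span_minimal[rotated]) (use assms(2-) in \<open>auto simp: entry_matrix_unit\<close>)
  then show ?thesis using assms(1) by auto
qed

theorem derivations_direct_sum:
  "direct_sum3 (derivations scale mul) (H_space scale n e \<alpha>) (L_space scale n e)
     (range (\<lambda>c. fun_scale scale c (g_map scale n e)))"
  unfolding direct_sum3_def
proof (intro conjI ballI impI set_eqI iffI)
  fix d assume "d \<in> derivations scale mul"
  from derivation_eq_normal_form[OF this]
  show "d \<in> {a + b + c | a b c. a \<in> H_space scale n e \<alpha> \<and> b \<in> L_space scale n e \<and>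
      c \<in> range (\<lambda>c. fun_scale scale c (g_map scale n e))}"
    unfolding normal_form_def using H_part_in L_part_in by blast
next
  fix d assume "d \<in> {a + b + c | a b c. a \<in> H_space scale n e \<alpha> \<and> b \<in> L_space scale n e \<and>
      c \<in> range (\<lambda>c. fun_scale scale c (g_map scale n e))}"
  then show "d \<in> derivations scale mul"
    using H_space_derivations L_space_derivations g_map_derivation
    by (auto intro!: endo.subspace_add[OF subspace_derivations]
        endo.subspace_scale[OF subspace_derivations])
next
  fix a b c
  assume a: "a \<in> H_space scale n e \<alpha>" and b: "b \<in> L_space scale n e"
    and c: "c \<in> range (\<lambda>c. fun_scale scale c (g_map scale n e))"
    and sum: "a + b + c = 0"
  obtain k where k: "c = fun_scale scale k (g_map scale n e)" using c by auto
  have entries: "entry r s a + entry r s b + entry r s c = 0" for r s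
    using sum entry_zero[of r s] by (simp flip: entry_add)
  have "k = 0"
    using entries[of 1 1] H_space_entries(1)[OF a, of 1] L_space_entries[OF b, of 1 1] n_ge_2
    by (simp add: k entry_scale entry_g_map)
  then show c0: "c = 0" using k by simp
  have "Vector_Spaces.linear scale scale b"
    using b L_space_derivations by (auto simp: derivations_def)
  then show b0: "b = 0"
  proof (rule endo_eqI)
    show "Vector_Spaces.linear scale scale (0 :: 'v \<Rightarrow> 'v)"
      using endo.subspace_0[OF subspace_linear] by simp
    fix r s assume rs: "r \<in> {1..n}" "s \<in> {1..n}"
    show "entry r s b = entry r s 0"
      using entries[of n s] H_space_entries(2)[OF a, of s] L_space_entries[OF b rs] rs
      by (cases "r = n") (auto simp: c0)
  qed
  show "a = 0" using sum b0 c0 by simp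
qed

section \<open>The dimension\<close>

lemma card_below_diagonal: "card (below_diagonal m) = m * (m - 1) div 2"
proof (induction m)
  case 0
  have "below_diagonal 0 = {}" by (auto simp: below_diagonal_def)
  then show ?case by simp
next
  case (Suc m)
  have "below_diagonal (Suc m) = below_diagonal m \<union> {1..m} \<times> {Suc m}"
    by (auto simp: below_diagonal_def)
  moreover have "below_diagonal m \<inter> {1..m} \<times> {Suc m} = {}"
    by (auto simp: below_diagonal_def)
  ultimately have "card (below_diagonal (Suc m)) = card (below_diagonal m) + m"
    by (simp add: card_Un_disjoint finite_below_diagonal)
  also have "\<dots> = Suc m * (Suc m - 1) div 2"
  proof -
    have "Suc m * (Suc m - 1) = m * (m - 1) + m * 2" by (cases m) auto
    then show ?thesis by (simp add: Suc.IH)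
  qed
  finally show ?case .
qed

text \<open>A derivation is sent to its entries below the diagonal, enumerated by \<open>p\<close>, and its first
  diagonal entry; the inverse map is \<open>normal_form\<close>. The count is that of all places below the
  diagonal of an \<open>n\<close> by \<open>n\<close> matrix because \<open>H\<close> accounts for the rows before the last and
  \<open>L\<close> for the last row.\<close>

theorem derivations_isomorphic:
  "linear_isomorphic (fun_scale scale) (derivations scale mul)
     coord_scale (coord_space (n * (n - 1) div 2) \<times> (UNIV :: 'k set))"
proof -
  let ?N = "n * (n - 1) div 2"
  obtain p where p: "bij_betw p {0..<?N} (below_diagonal n)"
    using ex_bij_betw_nat_finite[OF finite_below_diagonal] card_below_diagonal by metis
  define q where "q = the_inv_into {0..<?N} p"
  define \<phi> where "\<phi> d = ((\<lambda>k. if k < ?N then entry (snd (p k)) (fst (p k)) d else 0), entry 1 1 d)"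
    for d
  define \<psi> where "\<psi> x = normal_form (\<lambda>r s. fst x (q (s, r))) (snd x)" for x :: "(nat \<Rightarrow> 'k) \<times> 'k"
  have p_mem: "p k \<in> below_diagonal n" if "k < ?N" for k
    using bij_betwE[OF p] that by auto
  have q_p: "q (p k) = k" if "k < ?N" for k
    using that p by (auto simp: q_def bij_betw_def the_inv_into_f_f)
  have p_q: "p (q x) = x" and q_less: "q x < ?N" if "x \<in> below_diagonal n" for x
  proof -
    have "x \<in> p ` {0..<?N}" using that p by (simp add: bij_betw_def)
    then obtain k where "k < ?N" "x = p k" by auto
    then show "p (q x) = x" "q x < ?N" using q_p by auto
  qed
  have "bij_betw \<phi> (derivations scale mul) (coord_space ?N \<times> UNIV)"
  proof (rule bij_betw_byWitness[where f' = \<psi>])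
    show "\<forall>d\<in>derivations scale mul. \<psi> (\<phi> d) = d"
    proof
      fix d assume d: "d \<in> derivations scale mul"
      have "Vector_Spaces.linear scale scale (\<psi> (\<phi> d))" unfolding \<psi>_def by (rule linear_normal_form)
      moreover have "entry r s (\<psi> (\<phi> d))
          = entry r s (normal_form (\<lambda>r s. entry r s d) (entry 1 1 d))"
        if rs: "r \<in> {1..n}" "s \<in> {1..n}" for r s
        using rs p_q q_less by (auto simp: \<psi>_def \<phi>_def entry_normal_form below_diagonal_def)
      ultimately have "\<psi> (\<phi> d) = normal_form (\<lambda>r s. entry r s d) (entry 1 1 d)"
        using endo_eqI linear_normal_form by blast
      then show "\<psi> (\<phi> d) = d" using derivation_eq_normal_form[OF d] by simp
    qed
    show "\<forall>x\<in>coord_space ?N \<times> UNIV. \<phi> (\<psi> x) = x"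
    proof
      fix x :: "(nat \<Rightarrow> 'k) \<times> 'k" assume x: "x \<in> coord_space ?N \<times> UNIV"
      have "entry (snd (p k)) (fst (p k)) (\<psi> x) = fst x k" if "k < ?N" for k
        using p_mem[OF that] q_p[OF that]
        by (auto simp: \<psi>_def entry_normal_form below_diagonal_def)
      moreover have "entry 1 1 (\<psi> x) = snd x"
        using n_ge_2 by (simp add: \<psi>_def entry_normal_form)
      ultimately show "\<phi> (\<psi> x) = x"
        using x by (auto simp: \<phi>_def coord_space_def prod_eq_iff fun_eq_iff)
    qed
    show "\<phi> ` derivations scale mul \<subseteq> coord_space ?N \<times> UNIV"
      by (auto simp: \<phi>_def coord_space_def)
    show "\<psi> ` (coord_space ?N \<times> UNIV) \<subseteq> derivations scale mul"
      by (auto simp: \<psi>_def normal_form_derivation)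
  qed
  moreover have "\<phi> (x + y) = \<phi> x + \<phi> y" for x y
    by (auto simp: \<phi>_def entry_add fun_eq_iff)
  moreover have "\<phi> (fun_scale scale c x) = coord_scale c (\<phi> x)" for c x
    by (auto simp: \<phi>_def Defs.coord_scale_def entry_scale fun_eq_iff)
  ultimately show ?thesis
    unfolding linear_isomorphic_def by blast
qed

end


section \<open>Squares of basis vectors\<close>

lemma mul_power_eigenvector:
  fixes scale :: "'k::field \<Rightarrow> 'v::ab_group_add \<Rightarrow> 'v"
  assumes "comm_algebra scale mul"
    and "mul (mul a a) a = scale c (mul a a)"
  shows "mul_power mul a (Suc (Suc k)) = scale (c ^ k) (mul a a)"
proof -
  interpret comm_algebra scale mul by fact
  show ?thesis
    by (induction k) (simp_all add: assms(2) mul_scale_left mult.commute)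
qed

text \<open>By orthogonality, multiplication by \<open>e i\<close> only sees the \<open>i\<close>-th coordinate, hence
  maps \<open>e i \<cdot> e i\<close> to a multiple of itself. Nilpotency makes this multiple 0, and associativity
  shows that all the other basis vectors annihilate the square.\<close>

lemma square_basis_annihilator:
  fixes scale :: "'k::field \<Rightarrow> 'v::ab_group_add \<Rightarrow> 'v"
  assumes alg: "comm_algebra scale mul" and assoc: "associative mul" and nil: "nil_algebra mul"
    and nb: "natural_basis scale mul n e" and i: "i \<in> {1..n}"
  shows "mul (e i) (e i) \<in> annihilator mul"
proof -
  interpret comm_algebra scale mul by fact
  interpret indexed_basis scale n e
    using nb by unfold_locales (auto simp: natural_basis_def)
  let ?q = "mul (e i) (e i)"
  have orth: "mul (e j) (e k) = 0" if "j \<in> {1..n}" "k \<in> {1..n}" "j \<noteq> k" for j k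
    using nb that by (auto simp: natural_basis_def)
  define c where "c = coord i ?q"
  have "mul (e i) = (\<lambda>v. scale (coord i v) ?q)"
    by (rule linear_eq_basisI[OF linear_mul_right linear_endoI])
      (use i orth in \<open>auto simp: coord_add coord_scale scale_left_distrib coord_basis\<close>)
  then have cube: "mul ?q (e i) = scale c ?q"
    unfolding c_def by (metis mul_commute)
  have "scale c ?q = 0"
  proof (rule ccontr)
    assume nz: "scale c ?q \<noteq> 0"
    obtain m where m: "m \<ge> 1" "mul_power mul (e i) m = 0"
      using nil by (auto simp: nil_algebra_def)
    have "e i \<noteq> 0" using nz linear_0[OF linear_mul_right, of 0] by auto
    then have "m \<noteq> 1" using m by auto
    with m(1) obtain k where "m = Suc (Suc k)"
      by (metis One_nat_def Suc_le_D le_SucE not_less_eq_eq)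
    then have "scale (c ^ k) ?q = 0"
      using m(2) mul_power_eigenvector[OF alg cube, of k] by simp
    then show False using nz by auto
  qed
  with cube have zero_i: "mul ?q (e i) = 0" by simp
  have "mul ?q (e j) = 0" if "j \<in> {1..n}" for j
  proof (cases "j = i")
    case False
    have "mul ?q (e j) = mul (e i) (mul (e i) (e j))"
      using assoc by (simp add: associative_def)
    also have "\<dots> = 0" using orth i that False linear_0[OF linear_mul_right] by auto
    finally show ?thesis .
  qed (use zero_i in simp)
  then have "mul ?q = (\<lambda>v. 0)"
    by (intro linear_eq_basisI[OF linear_mul_right linear_endoI]) auto
  then show ?thesis by (simp add: annihilator_def)
qed

lemma basis_square_nonzero:
  fixes scale :: "'k::field \<Rightarrow> 'v::ab_group_add \<Rightarrow> 'v"
  assumes alg: "comm_algebra scale mul" and nb: "natural_basis scale mul n e"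
    and i: "i \<in> {1..n}" "i \<noteq> n" and ann: "annihilator mul = module.span scale {e n}"
  shows "mul (e i) (e i) \<noteq> 0"
proof
  assume sq: "mul (e i) (e i) = 0"
  interpret comm_algebra scale mul by fact
  interpret indexed_basis scale n e
    using nb by unfold_locales (auto simp: natural_basis_def)
  have "mul (e i) (e s) = 0" if "s \<in> {1..n}" for s
    using nb i sq that unfolding natural_basis_def by (cases "s = i") auto
  then have "mul (e i) = (\<lambda>v. 0)"
    by (intro linear_eq_basisI[OF linear_mul_right linear_endoI]) auto
  then have "e i \<in> annihilator mul" by (simp add: annihilator_def)
  then obtain c where "e i = scale c (e n)" by (auto simp: ann span_singleton)
  then have "coord i (e i) = c * coord i (e n)" using coord_scale by metis
  then show False using i by (auto simp: coord_basis)
qed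

theorem mainTheorem5:
  fixes scale :: "'k::field \<Rightarrow> 'v::ab_group_add \<Rightarrow> 'v"
    and mul :: "'v \<Rightarrow> 'v \<Rightarrow> 'v"
    and n :: nat and e :: "nat \<Rightarrow> 'v"
  assumes "CHAR('k) \<noteq> 2"
    and "evolution_algebra scale mul"
    and "associative mul"
    and "nil_algebra mul"
    and "indecomposable_algebra scale mul"
    and "vector_space.dim scale (UNIV :: 'v set) = n" and "n \<ge> 3"
    and "vector_space.dim scale (annihilator mul) = 1"
    and "natural_basis scale mul n e"
    and "annihilator mul = module.span scale {e n}"
  shows "(\<exists>\<alpha>. \<forall>i\<in>{1..n - 1}. \<alpha> i \<noteq> 0 \<and> mul (e i) (e i) = scale (\<alpha> i) (e n)) \<and>
    mul (e n) (e n) = 0 \<and>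
    (\<forall>\<alpha>. (\<forall>i\<in>{1..n - 1}. \<alpha> i \<noteq> 0 \<and> mul (e i) (e i) = scale (\<alpha> i) (e n)) \<longrightarrow>
      direct_sum3 (derivations scale mul)
        (H_space scale n e \<alpha>)
        (L_space scale n e)
        (range (\<lambda>c. fun_scale scale c (g_map scale n e)))) \<and>
    linear_isomorphic (fun_scale scale) (derivations scale mul)
      coord_scale (coord_space (n * (n - 1) div 2) \<times> (UNIV :: 'k set))"
proof -
  interpret evolution_algebra scale mul by fact
  have alg: "comm_algebra scale mul" by unfold_locales
  interpret indexed_basis scale n e
    using assms(9) by unfold_locales (auto simp: natural_basis_def)
  have two: "(2::'k) \<noteq> 0"
  proof
    assume "(2::'k) = 0"
    then have "CHAR('k) dvd 2"
      using of_nat_eq_0_iff_char_dvd[where 'a = 'k, of 2] by simp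
    moreover from this have "CHAR('k) \<le> 2"
      by (rule dvd_imp_le) simp
    moreover have "CHAR('k) \<noteq> 0"
      using \<open>CHAR('k) dvd 2\<close> by (intro notI) simp
    ultimately show False
      using assms(1) CHAR_not_1[where 'a = 'k] by linarith
  qed
  have ex: "\<exists>a. a \<noteq> 0 \<and> mul (e i) (e i) = scale a (e n)" if i: "i \<in> {1..n - 1}" for i
  proof -
    have i': "i \<in> {1..n}" "i \<noteq> n" using i by auto
    have "mul (e i) (e i) \<in> span {e n}"
      using square_basis_annihilator[OF alg assms(3,4,9) i'(1)] assms(10) by simp
    then show ?thesis
      using basis_square_nonzero[OF alg assms(9) i' assms(10)] by (auto simp: span_singleton)
  qed
  have last: "mul (e n) (e n) = 0"
    using assms(10) span_base[of "e n" "{e n}"] by (auto simp: annihilator_def)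
  obtain \<beta> where \<beta>: "\<forall>i\<in>{1..n - 1}. \<beta> i \<noteq> 0 \<and> mul (e i) (e i) = scale (\<beta> i) (e n)"
    using ex by metis
  have frame: "line_valued_evolution scale mul n e \<alpha>"
    if "\<forall>i\<in>{1..n - 1}. \<alpha> i \<noteq> 0 \<and> mul (e i) (e i) = scale (\<alpha> i) (e n)" for \<alpha>
    using that assms(7,9) two last by unfold_locales (auto simp: natural_basis_def)
  show ?thesis
    using \<beta> last line_valued_evolution.derivations_direct_sum[OF frame]
      line_valued_evolution.derivations_isomorphic[OF frame[OF \<beta>]]
    by blast
qed

end
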